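(* For $i=1,\dots,n$, $d_i=d-a_i$, where $d=\sum_{j=1}^{n+2}b_j-\sum_{i=1}^na_i$.
   Context: Let $\mathbb{K}$ be an algebraically closed field, $R=\mathbb{K}[x,y,z]$ with the standard grading, $n>0$ an integer, and $a_1\le a_2\le\cdots\le a_n$, $b_1\le b_2\le\cdots\le b_{n+2}$ integers. Let $\varphi:\bigoplus_{j=1}^{n+2}R(-b_j)\to\bigoplus_{i=1}^nR(-a_i)$ be a degree-zero graded $R$-linear map with matrix $(\varphi_{i,j})$, such that each entry $\varphi_{i,j}$ is either $0$ or homogeneous of positive degree (necessarily equal to $b_j-a_i$). Let $I\subset R$ be the ideal generated by the $n\times n$ minors of $\varphi$, and assume that $I$ has codimension $3$. Let $M=\operatorname{coker}(\varphi)$; it is a graded $R$-module of finite length. For $r\ne j$ in $\{1,\dots,n+2\}$, $\Phi_{r,j}$ denotes the $n\times n$ minor of $\varphi$ obtained by deleting columns $r$ and $j$. The minimal graded free resolution of $M$ is given by the Buchsbaum–Rim complex $$0\to\bigoplus_{i=1}^nR(-d_i)\xrightarrow{\ \delta\ }\bigoplus_{j=1}^{n+2}R(-c_j)\xrightarrow{\ \varepsilon\ }\bigoplus_{j=1}^{n+2}R(-b_j)\xrightarrow{\ \varphi\ }\bigoplus_{i=1}^nR(-a_i),$$ where in the standard bases the $(r,j)$ entry of $\varepsilon$ is $(-1)^{n-r+1}\Phi_{r,j}$ if $r<j$, $0$ if $r=j$, and $(-1)^{n-r}\Phi_{r,j}$ if $r>j$; and the $(j,i)$ entry of $\delta$ is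 $(-1)^{j+1}\varphi_{i,j}$. The integers $c_j,d_i$ are the degrees of the corresponding basis elements, so that $\varepsilon$ and $\delta$ are homogeneous of degree zero. *)

theory Defs
  imports
    "HOL-Library.Extended_Nat"
    "HOL-Computational_Algebra.Polynomial"
    "HOL-Algebra.Ideal"
    "Jordan_Normal_Form.Determinant"
    "Jordan_Normal_Form.DL_Submatrix"
    "Jordan_Normal_Form.VS_Connect"
begin

text \<open>
  The ring \<open>\<bbbK>[x,y,z]\<close> is the iterated polynomial ring \<open>\<bbbK>[x][y][z]\<close>. All index
  ranges start at 0, so an index here is one less than the corresponding index in the usual
  \<open>1, \<dots>, n\<close> and \<open>1, \<dots>, n + 2\<close> numbering of rows and columns.
\<close>

type_synonym 'k poly3 = "'k poly poly poly"

text \<open>The coefficient of \<open>x^i y^j z^k\<close> in \<open>p\<close> is \<open>coeff (coeff (coeff p k) j) i\<close>.\<close>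

definition graded_part :: "int \<Rightarrow> 'k::zero poly3 set" where
  "graded_part t =
     {p. \<forall>i j k. coeff (coeff (coeff p k) j) i \<noteq> 0 \<longrightarrow> int (i + j + k) = t}"

text \<open>
  Degree \<open>t\<close> part of the direct sum of the \<open>R(-e j)\<close> over \<open>j < m\<close>, where
  \<open>R(-e)\<^sub>t = R\<^sub>t\<^sub>-\<^sub>e\<close>.
\<close>

definition free_graded_part :: "nat \<Rightarrow> (nat \<Rightarrow> int) \<Rightarrow> int \<Rightarrow> 'k::zero poly3 vec set" where
  "free_graded_part m e t = {v \<in> carrier_vec m. \<forall>j<m. v $ j \<in> graded_part (t - e j)}"

text \<open>
  \<open>A\<close> is the matrix of a degree-zero graded map from the direct sum of the \<open>R(-e j)\<close>,
  \<open>j < m\<close>, to the direct sum of the \<open>R(-f i)\<close>, \<open>i < l\<close>.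
\<close>

definition degree_zero_map ::
    "'k::comm_ring_1 poly3 mat \<Rightarrow> nat \<Rightarrow> (nat \<Rightarrow> int) \<Rightarrow> nat \<Rightarrow> (nat \<Rightarrow> int) \<Rightarrow> bool" where
  "degree_zero_map A m e l f \<longleftrightarrow>
     A \<in> carrier_mat l m \<and>
     (\<forall>t. \<forall>v \<in> free_graded_part m e t. A *\<^sub>v v \<in> free_graded_part l f t)"

definition maximal_minors_ideal :: "nat \<Rightarrow> 'r::comm_ring_1 mat \<Rightarrow> 'r set" where
  "maximal_minors_ideal n A =
     genideal class_ring {det (submatrix A UNIV J) |J. J \<subseteq> {..<dim_col A} \<and> card J = n}"

definition height :: "'r::comm_ring_1 set \<Rightarrow> enat" where
  "height P = Sup {enat k |k. \<exists>C :: nat \<Rightarrow> 'r set.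
     (\<forall>i\<le>k. primeideal (C i) class_ring) \<and> (\<forall>i<k. C i \<subset> C (Suc i)) \<and> C k = P}"

definition codimension :: "'r::comm_ring_1 set \<Rightarrow> enat" where
  "codimension I = Inf {height P |P. primeideal P class_ring \<and> I \<subseteq> P}"

definition minor_deleting :: "'r::comm_ring_1 mat \<Rightarrow> nat \<Rightarrow> nat \<Rightarrow> 'r" where
  "minor_deleting A r j = det (submatrix A UNIV (- {r, j}))"

text \<open>
  The differentials of the Buchsbaum--Rim complex
  \<open>R^n \<rightarrow> R^(n+2) \<rightarrow> R^(n+2) \<rightarrow> R^n\<close> of \<open>A\<close>, in standard bases, are \<open>delta_mat n A\<close>,
  \<open>eps_mat n A\<close> and \<open>A\<close>. With 1-based indices their signs are \<open>(-1)^(n-r+1)\<close> for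
  \<open>r < j\<close>, \<open>(-1)^(n-r)\<close> for \<open>r > j\<close>, and \<open>(-1)^(j+1)\<close>. For the 0-based indices these
  become \<open>(-1)^(n-r)\<close>, \<open>(-1)^(n-r-1)\<close> and \<open>(-1)^j\<close>. Since \<open>n - r\<close> may be negative, \<open>n + r\<close>,
  which has the same parity, is used as the exponent.
\<close>

definition eps_mat :: "nat \<Rightarrow> 'r::comm_ring_1 mat \<Rightarrow> 'r mat" where
  "eps_mat n A = mat (n + 2) (n + 2) (\<lambda>(r, j).
     if r < j then (-1) ^ (n + r) * minor_deleting A r j
     else if r = j then 0
     else (-1) ^ (n + r + 1) * minor_deleting A r j)"

definition delta_mat :: "nat \<Rightarrow> 'r::comm_ring_1 mat \<Rightarrow> 'r mat" where
  "delta_mat n A = mat (n + 2) n (\<lambda>(j, i). (-1) ^ j * A $$ (i, j))"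

end

theory Submission
  imports Defs "Berlekamp_Zassenhaus.Unique_Factorization_Poly"
begin

text \<open>
  Comparing degrees gives \<open>d\<^sub>i = d - a\<^sub>i\<close> as soon as some column \<open>j\<close> has \<open>\<phi>\<^sub>i\<^sub>j \<noteq> 0\<close> and
  \<open>\<Phi>\<^sub>r\<^sub>j \<noteq> 0\<close> for some \<open>r\<close>. A zero row of \<open>\<phi>\<close> would make all maximal minors vanish, so the point is that
  no column \<open>j\<close> can occur in every nonzero maximal minor. If one did, the remaining columns would have
  a common left kernel vector \<open>w\<close>, which may be chosen primitive since \<open>R\<close> is factorial. Multiplying
  by adjugates shows that \<open>w \<cdot> \<phi>\<^sub>j\<close> divides every maximal minor. It vanishes at the origin, hence is
  not a unit, so \<open>I\<close> lies in a principal prime ideal and has codimension at most 1.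
\<close>

section \<open>Graded parts\<close>

lemma zero_in_graded_part [simp]: "0 \<in> graded_part t"
  by (simp add: graded_part_def)

lemma one_in_graded_part: "(1 :: 'k::comm_semiring_1 poly3) \<in> graded_part 0"
  by (auto simp: graded_part_def coeff_1 split: if_splits)

lemma add_in_graded_part:
  fixes p q :: "'k::comm_monoid_add poly3"
  assumes "p \<in> graded_part t" "q \<in> graded_part t"
  shows "p + q \<in> graded_part t"
  using assms unfolding graded_part_def by (force simp: add_eq_0_iff_both_eq_0)

lemma uminus_in_graded_part_iff [simp]:
  fixes p :: "'k::ab_group_add poly3"
  shows "- p \<in> graded_part t \<longleftrightarrow> p \<in> graded_part t"
  by (simp add: graded_part_def)

lemma minus_one_power_mult_in_graded_part_iff [simp]:
  fixes p :: "'k::comm_ring_1 poly3"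
  shows "(-1) ^ e * p \<in> graded_part t \<longleftrightarrow> p \<in> graded_part t"
  by (simp add: minus_one_power_iff)

lemma sum_in_graded_part:
  fixes f :: "'a \<Rightarrow> 'k::comm_monoid_add poly3"
  assumes "\<And>x. x \<in> S \<Longrightarrow> f x \<in> graded_part t"
  shows "sum f S \<in> graded_part t"
  using assms by (induction S rule: infinite_finite_induct) (auto intro: add_in_graded_part)

text \<open>A nonzero coefficient of a product requires a nonzero summand in its convolution. The
  proof unfolds one convolution per variable, from the outermost variable inwards.\<close>

lemma mult_in_graded_part:
  fixes p q :: "'k::comm_semiring_1 poly3"
  assumes p: "p \<in> graded_part s" and q: "q \<in> graded_part t"
  shows "p * q \<in> graded_part (s + t)"
proof -
  have "int (i + j + k) = s + t" if "coeff (coeff (coeff (p * q) k) j) i \<noteq> 0" for i j k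
  proof -
    have "(\<Sum>k'\<le>k. coeff (coeff (coeff p k' * coeff q (k - k')) j) i) \<noteq> 0"
      using that by (simp add: coeff_mult[of p q] coeff_sum)
    then obtain k' where k': "k' \<le> k" "coeff (coeff (coeff p k' * coeff q (k - k')) j) i \<noteq> 0"
      by (metis (no_types, lifting) atMost_iff sum.neutral)
    then have "(\<Sum>j'\<le>j. coeff (coeff (coeff p k') j' * coeff (coeff q (k - k')) (j - j')) i) \<noteq> 0"
      by (simp add: coeff_mult[of "coeff p k'"] coeff_sum)
    then obtain j' where j': "j' \<le> j"
      "coeff (coeff (coeff p k') j' * coeff (coeff q (k - k')) (j - j')) i \<noteq> 0"
      by (metis (no_types, lifting) atMost_iff sum.neutral)
    then obtain i' where i': "i' \<le> i"
      "coeff (coeff (coeff p k') j') i' * coeff (coeff (coeff q (k - k')) (j - j')) (i - i') \<noteq> 0"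
      by (metis (no_types, lifting) atMost_iff coeff_mult sum.neutral)
    then have "coeff (coeff (coeff p k') j') i' \<noteq> 0"
      "coeff (coeff (coeff q (k - k')) (j - j')) (i - i') \<noteq> 0"
      by auto
    then have "int (i' + j' + k') = s" "int ((i - i') + (j - j') + (k - k')) = t"
      using p q unfolding graded_part_def by blast+
    then show ?thesis
      using k' j' i' by simp
  qed
  then show ?thesis
    by (simp add: graded_part_def)
qed

lemma prod_in_graded_part:
  fixes f :: "'a \<Rightarrow> 'k::comm_semiring_1 poly3"
  assumes "finite S" "\<And>x. x \<in> S \<Longrightarrow> f x \<in> graded_part (t x)"
  shows "prod f S \<in> graded_part (sum t S)"
  using assms by (induction S) (auto intro: mult_in_graded_part one_in_graded_part)

text \<open>Any nonzero coefficient determines the degree, whereas \<open>0\<close> lies in every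
  graded part. This is why the final degree comparisons are made at nonzero entries and nonzero
  minors.\<close>

lemma graded_part_unique:
  assumes "p \<in> graded_part s" "p \<in> graded_part t" "p \<noteq> 0"
  shows "s = t"
proof -
  obtain i j k where "coeff (coeff (coeff p k) j) i \<noteq> 0"
    using \<open>p \<noteq> 0\<close> by (metis coeff_0 poly_eqI)
  then show ?thesis
    using assms unfolding graded_part_def by blast
qed

text \<open>The \<open>j\<close>-th basis vector is homogeneous of degree \<open>e j\<close>, and
  its image is the \<open>j\<close>-th column of \<open>A\<close>.\<close>

lemma degree_zero_map_entry:
  fixes A :: "'k::comm_ring_1 poly3 mat"
  assumes "degree_zero_map A m e l f" "i < l" "j < m"
  shows "A $$ (i, j) \<in> graded_part (e j - f i)"
proof -
  have A: "A \<in> carrier_mat l m"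
    using assms(1) by (simp add: degree_zero_map_def)
  have "unit_vec m j \<in> free_graded_part m e (e j)"
    by (auto simp: free_graded_part_def unit_vec_def one_in_graded_part)
  then have "A *\<^sub>v unit_vec m j \<in> free_graded_part l f (e j)"
    using assms(1) by (auto simp: degree_zero_map_def)
  moreover have "(A *\<^sub>v unit_vec m j) $ i = A $$ (i, j)"
    using A assms(2,3) by simp
  ultimately show ?thesis
    using assms(2) by (auto simp: free_graded_part_def)
qed

text \<open>In each Leibniz term the permutation only reorders the values of \<beta>, so all terms
  have the same degree.\<close>

lemma det_in_graded_part:
  fixes A :: "'k::comm_ring_1 poly3 mat"
  assumes A: "A \<in> carrier_mat n n"
    and deg: "\<And>i j. i < n \<Longrightarrow> j < n \<Longrightarrow> A $$ (i, j) \<in> graded_part (\<beta> j - \<alpha> i)"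
  shows "det A \<in> graded_part ((\<Sum>j<n. \<beta> j) - (\<Sum>i<n. \<alpha> i))"
  unfolding det_def'[OF A]
proof (rule sum_in_graded_part)
  fix \<pi> assume "\<pi> \<in> {\<pi>. \<pi> permutes {0..<n}}"
  then have \<pi>: "\<pi> permutes {0..<n}"
    by simp
  have "(\<Prod>i = 0..<n. A $$ (i, \<pi> i)) \<in> graded_part (\<Sum>i = 0..<n. \<beta> (\<pi> i) - \<alpha> i)"
    using permutes_in_image[OF \<pi>] by (intro prod_in_graded_part deg) auto
  also have "(\<Sum>i = 0..<n. \<beta> (\<pi> i) - \<alpha> i) = (\<Sum>j<n. \<beta> j) - (\<Sum>i<n. \<alpha> i)"
    using sum.permute[OF \<pi>, of \<beta>] by (simp add: sum_subtractf o_def lessThan_atLeast0)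
  finally show "signof \<pi> * (\<Prod>i = 0..<n. A $$ (i, \<pi> i))
      \<in> graded_part ((\<Sum>j<n. \<beta> j) - (\<Sum>i<n. \<alpha> i))"
    by (simp add: sign_def)
qed

section \<open>Maximal minors\<close>

lemma bij_betw_pick:
  assumes "finite J"
  shows "bij_betw (pick J) {..<card J} J"
proof -
  have "inj_on (pick J) {..<card J}"
    by (rule inj_onI) (metis lessThan_iff nat_neq_iff pick_mono_le)
  moreover have "pick J ` {..<card J} \<subseteq> J"
    by (auto intro: pick_in_set_le)
  ultimately show ?thesis
    using assms by (metis bij_betw_def card_image card_lessThan card_subset_eq)
qed

text \<open>\<open>minor_deleting\<close> selects columns by the infinite set
  \<open>- {r, j}\<close>. Cutting down to the actual column range gives a finite set whose
  cardinality can be counted.\<close>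

lemma submatrix_UNIV_restrict:
  "submatrix A UNIV J = submatrix A UNIV (J \<inter> {..<dim_col A})"
proof -
  have J: "J \<inter> {..<dim_col A} = {k. k < dim_col A \<and> k \<in> J}"
    by auto
  have eq: "{k. k < dim_col A \<and> k \<in> J \<inter> {..<dim_col A}} = {k. k < dim_col A \<and> k \<in> J}"
    by auto
  show ?thesis
    by (rule eq_matI) (auto simp: submatrix_def eq J pick_reduce_set[of _ _ J])
qed

context
  fixes A :: "'r::comm_ring_1 mat" and n m :: nat and J :: "nat set"
  assumes A: "A \<in> carrier_mat n m" and J: "J \<subseteq> {..<m}" "card J = n"
begin

lemma submatrix_UNIV_carrier: "submatrix A UNIV J \<in> carrier_mat n n"
proof -
  have "{j. j < m \<and> j \<in> J} = J"
    using J by auto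
  then show ?thesis
    using A J by (auto simp: dim_submatrix)
qed

lemma submatrix_UNIV_index:
  assumes "i < n" "k < n"
  shows "submatrix A UNIV J $$ (i, k) = A $$ (i, pick J k)"
proof -
  have "{j. j < m \<and> j \<in> J} = J"
    using J by auto
  then show ?thesis
    using A J assms by (subst submatrix_index) (auto simp: pick_UNIV)
qed

lemma pick_less_dim:
  assumes "k < n"
  shows "pick J k \<in> J" "pick J k < m"
proof -
  show "pick J k \<in> J"
    using assms J(2) by (intro pick_in_set_le) simp
  then show "pick J k < m"
    using J(1) by blast
qed

lemma col_submatrix_UNIV:
  assumes "k < n"
  shows "col (submatrix A UNIV J) k = col A (pick J k)"
  using A assms submatrix_UNIV_carrier pick_less_dim[OF assms]
  by (intro eq_vecI) (auto simp: submatrix_UNIV_index)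

lemma transpose_submatrix_mult_vec:
  "transpose_mat (submatrix A UNIV J) *\<^sub>v w = vec n (\<lambda>k. col A (pick J k) \<bullet> w)"
  using submatrix_UNIV_carrier by (intro eq_vecI) (auto simp: col_submatrix_UNIV)

text \<open>Since \<open>pick J\<close> reaches all of \<open>J\<close>, left kernels depend only on
  the set of columns and not on their positions. This makes kernels for different column sets
  comparable.\<close>

lemma transpose_submatrix_mult_vec_eq_0_iff:
  "transpose_mat (submatrix A UNIV J) *\<^sub>v w = 0\<^sub>v n \<longleftrightarrow> (\<forall>k\<in>J. col A k \<bullet> w = 0)"
proof -
  have "finite J"
    using J by (auto intro: finite_subset)
  then have "pick J ` {..<n} = J"
    using bij_betw_pick J by (auto simp: bij_betw_def)
  then have "(\<forall>k\<in>J. col A k \<bullet> w = 0) \<longleftrightarrow> (\<forall>k<n. col A (pick J k) \<bullet> w = 0)"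
    by (metis (no_types, lifting) imageE imageI lessThan_iff)
  then show ?thesis
    by (auto simp: transpose_submatrix_mult_vec vec_eq_iff)
qed

text \<open>Let \<open>B\<close> be the transposed submatrix. Every entry of
  \<open>B *\<^sub>v w\<close> is \<open>0\<close> or \<open>col A j \<bullet> w\<close>, and
  multiplying by the adjugate of \<open>B\<close> turns this vector into
  \<open>det B \<cdot>\<^sub>v w\<close>. If \<open>j\<close> is not in \<open>J\<close>, the vector
  is zero and so is the product.\<close>

lemma col_scalar_prod_dvd_minor_mult:
  assumes w: "w \<in> carrier_vec n" and 0: "\<And>k. k \<in> J \<Longrightarrow> k \<noteq> j \<Longrightarrow> col A k \<bullet> w = 0" and i: "i < n"
  shows "col A j \<bullet> w dvd det (submatrix A UNIV J) * w $ i"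
proof -
  define B where "B = transpose_mat (submatrix A UNIV J)"
  have B: "B \<in> carrier_mat n n"
    using submatrix_UNIV_carrier by (simp add: B_def)
  note adj = adj_mat[OF B]
  define u where "u = B *\<^sub>v w"
  have u_dvd: "col A j \<bullet> w dvd u $ k" if "k < n" for k
    using that 0[OF pick_less_dim(1)[OF that]]
    by (cases "pick J k = j") (simp_all add: u_def B_def transpose_submatrix_mult_vec)
  have u: "u \<in> carrier_vec n"
    using B w by (simp add: u_def)
  have "adj_mat B *\<^sub>v u = (adj_mat B * B) *\<^sub>v w"
    using adj(1) B w by (simp add: u_def)
  also have "\<dots> = det B \<cdot>\<^sub>v w"
    using w by (auto simp: adj(3))
  finally have "det B * w $ i = row (adj_mat B) i \<bullet> u"
    using i w adj(1) by (metis carrier_matD(1) carrier_vecD index_mult_mat_vec index_smult_vec(1))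
  then have "col A j \<bullet> w dvd det B * w $ i"
    using u u_dvd by (auto simp: scalar_prod_def intro!: dvd_sum)
  then show ?thesis
    using submatrix_UNIV_carrier by (simp add: B_def det_transpose)
qed

end

lemma minor_in_graded_part:
  fixes A :: "'k::comm_ring_1 poly3 mat"
  assumes A: "A \<in> carrier_mat n m" and J: "J \<subseteq> {..<m}" "card J = n"
    and deg: "\<And>i j. i < n \<Longrightarrow> j < m \<Longrightarrow> A $$ (i, j) \<in> graded_part (\<beta> j - \<alpha> i)"
  shows "det (submatrix A UNIV J) \<in> graded_part ((\<Sum>j\<in>J. \<beta> j) - (\<Sum>i<n. \<alpha> i))"
proof -
  have "det (submatrix A UNIV J) \<in> graded_part ((\<Sum>k<n. \<beta> (pick J k)) - (\<Sum>i<n. \<alpha> i))"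
    using det_in_graded_part[OF submatrix_UNIV_carrier[OF A J], of "\<lambda>k. \<beta> (pick J k)" \<alpha>]
      submatrix_UNIV_index[OF A J] pick_less_dim[OF A J] deg by simp
  moreover have "(\<Sum>k<n. \<beta> (pick J k)) = (\<Sum>j\<in>J. \<beta> j)"
    using bij_betw_pick[of J] J by (intro sum.reindex_bij_betw) (auto intro: finite_subset)
  ultimately show ?thesis
    by simp
qed

lemma minor_deleting_eq:
  assumes "dim_col A = m"
  shows "minor_deleting A r j = det (submatrix A UNIV ({..<m} - {r, j}))"
proof -
  have "- {r, j} \<inter> {..<m} = {..<m} - {r, j}"
    by auto
  then show ?thesis
    using assms submatrix_UNIV_restrict[of A "- {r, j}"] by (simp add: minor_deleting_def)
qed

section \<open>Left kernels of sets of columns\<close>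

lemma minor_eq_0_iff_left_kernel:
  fixes A :: "'r::idom mat"
  assumes "A \<in> carrier_mat n m" "J \<subseteq> {..<m}" "card J = n"
  shows "det (submatrix A UNIV J) = 0 \<longleftrightarrow>
    (\<exists>w \<in> carrier_vec n. w \<noteq> 0\<^sub>v n \<and> (\<forall>k\<in>J. col A k \<bullet> w = 0))"
proof -
  note N = submatrix_UNIV_carrier[OF assms]
  have "det (submatrix A UNIV J) = det (transpose_mat (submatrix A UNIV J))"
    using N by (simp add: det_transpose)
  then show ?thesis
    using N by (auto simp: det_0_iff_vec_prod_zero[of _ n]
        transpose_submatrix_mult_vec_eq_0_iff[OF assms])
qed

text \<open>The columns in \<open>J - {j}\<close> have an essentially one-dimensional left kernel,
  because the minor on \<open>J\<close> is nonzero. Replacing \<open>j\<close> by any column outside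
  \<open>J\<close> gives a zero minor, so each such column is killed by a nonzero vector of this
  kernel, and hence by all of it.\<close>

lemma exists_left_kernel_of_other_columns:
  fixes A :: "'r::idom mat"
  assumes A: "A \<in> carrier_mat n m" and "n < m"
    and J: "J \<subseteq> {..<m}" "card J = n" and nz: "det (submatrix A UNIV J) \<noteq> 0"
    and 0: "\<forall>J \<subseteq> {..<m}. card J = n \<longrightarrow> j \<notin> J \<longrightarrow> det (submatrix A UNIV J) = 0"
  shows "\<exists>w \<in> carrier_vec n. w \<noteq> 0\<^sub>v n \<and> (\<forall>k<m. k \<noteq> j \<longrightarrow> col A k \<bullet> w = 0)"
proof -
  have j: "j \<in> J"
    using 0 J nz by blast
  have finJ: "finite J"
    using J by (auto intro: finite_subset)
  have colA: "col A k \<in> carrier_vec n" for k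
    using A by (simp add: col_def)
  have J_kernel: "w = 0\<^sub>v n" if "w \<in> carrier_vec n" "\<And>k. k \<in> J \<Longrightarrow> col A k \<bullet> w = 0" for w
    using nz minor_eq_0_iff_left_kernel[OF A J] that by blast
  have ex: "\<exists>v \<in> carrier_vec n. v \<noteq> 0\<^sub>v n \<and> (\<forall>k \<in> insert l (J - {j}). col A k \<bullet> v = 0)"
    if l: "l < m" "l \<notin> J" for l
  proof -
    let ?J = "insert l (J - {j})"
    have "?J \<subseteq> {..<m}" "card ?J = n" "j \<notin> ?J"
      using l J j finJ card_Suc_Diff1[OF finJ j] by auto
    then show ?thesis
      using 0 minor_eq_0_iff_left_kernel[OF A] by blast
  qed
  have "\<not> {..<m} \<subseteq> J"
    using card_mono[OF finJ, of "{..<m}"] J \<open>n < m\<close> by auto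
  then obtain l where "l < m" "l \<notin> J"
    by auto
  from ex[OF this] obtain w where w: "w \<in> carrier_vec n" "w \<noteq> 0\<^sub>v n"
    and w0: "\<And>k. k \<in> J \<Longrightarrow> k \<noteq> j \<Longrightarrow> col A k \<bullet> w = 0"
    by blast
  have "col A k \<bullet> w = 0" if k: "k < m" "k \<noteq> j" for k
  proof (cases "k \<in> J")
    case True
    then show ?thesis
      using w0 k by blast
  next
    case False
    obtain v where v: "v \<in> carrier_vec n" "v \<noteq> 0\<^sub>v n" "col A k \<bullet> v = 0"
      and v0: "\<And>k. k \<in> J \<Longrightarrow> k \<noteq> j \<Longrightarrow> col A k \<bullet> v = 0"
      using ex[OF k(1) False] by blast
    define c where "c = col A j \<bullet> v"
    define e where "e = col A j \<bullet> w"
    \<comment> \<open>Otherwise \<open>v\<close> would be a nonzero vector killing all columns in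
      \<open>J\<close>.\<close>
    have "c \<noteq> 0"
      using J_kernel[OF v(1)] v(2) v0 unfolding c_def by metis
    \<comment> \<open>The coefficients are chosen so that column \<open>j\<close> cancels. Then
      \<open>u\<close> kills all columns in \<open>J\<close>, so it vanishes and
      \<open>c \<cdot>\<^sub>v w\<close> equals \<open>e \<cdot>\<^sub>v v\<close>, which kills
      column \<open>k\<close>.\<close>
    define u where "u = c \<cdot>\<^sub>v w - e \<cdot>\<^sub>v v"
    have u: "col A k \<bullet> u = c * (col A k \<bullet> w) - e * (col A k \<bullet> v)" for k
      using colA[of k] v(1) w(1) by (simp add: u_def scalar_prod_minus_distrib[of _ n])
    have "u = 0\<^sub>v n"
    proof (rule J_kernel)
      show "u \<in> carrier_vec n"
        using v w by (simp add: u_def)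
      show "col A k \<bullet> u = 0" if "k \<in> J" for k
        using that v0 w0 u[of k] by (cases "k = j") (auto simp: c_def e_def)
    qed
    then have "c * (col A k \<bullet> w) = 0"
      using u[of k] v(3) colA[of k] by simp
    then show ?thesis
      using \<open>c \<noteq> 0\<close> by simp
  qed
  then show ?thesis
    using w by blast
qed

section \<open>Factorial domains\<close>

text \<open>Divide by the gcd of the entries. A nonunit dividing all quotients would enlarge the
  gcd.\<close>

lemma exists_primitive_part:
  fixes w :: "'r::ufd vec"
  assumes w: "w \<in> carrier_vec n" "w \<noteq> 0\<^sub>v n"
  obtains g v where "g \<noteq> 0" "v \<in> carrier_vec n" "w = g \<cdot>\<^sub>v v"
    "\<And>p. \<not> p dvd 1 \<Longrightarrow> \<exists>i<n. \<not> p dvd v $ i"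
proof -
  define g where "g = some_gcd.listgcd (list_of_vec w)"
  have mem: "w $ i \<in> set (list_of_vec w)" if "i < n" for i
    using that w by (metis carrier_vecD length_list_of_vec list_of_vec_index nth_mem)
  have "\<exists>q. w $ i = g * q" if "i < n" for i
    using some_gcd.listgcd[OF mem[OF that]] by (auto simp: g_def dvd_def)
  then obtain q where q: "\<And>i. i < n \<Longrightarrow> w $ i = g * q i"
    by metis
  show ?thesis
  proof
    show "w = g \<cdot>\<^sub>v vec n q"
      using w q by (intro eq_vecI) auto
    with w show "g \<noteq> 0"
      by (auto simp: vec_eq_iff)
    fix p :: 'r assume p: "\<not> p dvd 1"
    show "\<exists>i<n. \<not> p dvd vec n q $ i"
    proof (rule ccontr)
      assume "\<not> ?thesis"
      then have "g * p dvd w $ i" if "i < n" for i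
        using that q by (auto simp: mult_dvd_mono)
      then have "g * p dvd g"
        unfolding g_def using w
        by (intro some_gcd.listgcd_greatest) (auto simp: set_list_of_vec vec_set_def)
      then have "p dvd 1"
        using \<open>g \<noteq> 0\<close> by (metis dvd_mult_cancel_left mult.right_neutral)
      with p show False ..
    qed
  qed auto
qed

lemma exists_prime_elem_dvd:
  fixes x :: "'r::ufd"
  assumes "x \<noteq> 0" "\<not> x dvd 1"
  shows "\<exists>p. prime_elem p \<and> p dvd x"
proof -
  obtain F where F: "mset_factors F x"
    using mset_factors_exist[OF assms] by blast
  then obtain p where "p \<in># F"
    by (auto elim!: mset_factorsE)
  then show ?thesis
    using F mset_factors_imp_dvd[OF F] by (auto elim!: mset_factorsE)
qed

section \<open>Principal prime ideals, height and codimension\<close>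

lemma primeideal_multiples:
  fixes p :: "'r::idom"
  assumes "prime_elem p"
  shows "primeideal {x. p dvd x} (class_ring :: 'r ring)"
proof (rule primeidealI)
  have "PIdl\<^bsub>class_ring\<^esub> p = {x. p dvd x}"
    by (auto simp: cgenideal_def dvd_def mult.commute)
  then show "ideal {x. p dvd x} (class_ring :: 'r ring)"
    using cring.cgenideal_ideal[OF class_cring.is_cring, of p] by simp
  show "cring (class_ring :: 'r ring)"
    by (rule class_cring.is_cring)
  show "carrier class_ring \<noteq> {x. p dvd x}"
    using prime_elem_not_unit[OF assms] by (metis UNIV_I class_ring_simps(1) mem_Collect_eq)
  show "x \<in> {x. p dvd x} \<or> y \<in> {x. p dvd x}" if "x \<otimes>\<^bsub>class_ring\<^esub> y \<in> {x. p dvd x}" for x y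
    using that prime_elem_dvd_mult_iff[OF assms] by simp
qed

text \<open>A nonzero element of \<open>Q\<close> is a product of irreducibles, and primality puts
  one of them, \<open>f\<close>, in \<open>Q\<close>. As \<open>p\<close> divides \<open>f\<close>,
  the two are associates, so \<open>p\<close> is in \<open>Q\<close>, against strictness of the
  inclusion.\<close>

lemma primeideal_in_multiples:
  fixes p :: "'r::ufd"
  assumes p: "prime_elem p" and Q: "primeideal Q (class_ring :: 'r ring)" and sub: "Q \<subset> {x. p dvd x}"
  shows "Q = {0}"
proof -
  interpret Q: primeideal Q "class_ring :: 'r ring"
    by (rule Q)
  have one: "1 \<notin> Q"
    using Q.one_imp_carrier Q.I_notcarr by auto
  have closed: "x * y \<in> Q" if "x \<in> Q" for x y
    using Q.I_r_closed[OF that] by simp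
  have "q = 0" if q: "q \<in> Q" for q
  proof (rule ccontr)
    assume "q \<noteq> 0"
    moreover have "\<not> q dvd 1"
      using closed[OF q] one by (metis dvdE)
    ultimately obtain F where F: "mset_factors F q"
      using mset_factors_exist by blast
    have "\<exists>f \<in># G. f \<in> Q" if "prod_mset G \<in> Q" for G
      using that
    proof (induction G)
      case (add f G)
      then show ?case
        using Q.I_prime[of f "prod_mset G"] by auto
    qed (use one in simp)
    then obtain f where f: "f \<in># F" "f \<in> Q"
      using F q by (auto elim!: mset_factorsE)
    then have "irreducible f" "p dvd f"
      using F sub by (auto elim!: mset_factorsE)
    then have "f dvd p"
      using p by (metis irreducible_altdef prime_elem_not_unit)
    then have "p \<in> Q"
      using closed[OF f(2)] by (auto simp: dvd_def)
    then have "{x. p dvd x} \<subseteq> Q"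
      using closed by (auto simp: dvd_def)
    with sub show False
      by blast
  qed
  moreover have "0 \<in> Q"
    using Q.zero_closed by simp
  ultimately show ?thesis
    by blast
qed

text \<open>In a chain with two strict steps, the ideal just below the top would be
  \<open>{0}\<close>, yet it strictly contains another ideal.\<close>

lemma height_multiples_le:
  fixes p :: "'r::ufd"
  assumes p: "prime_elem p"
  shows "height {x. p dvd x} \<le> 1"
  unfolding height_def
proof (rule Sup_least, clarify)
  fix k and C :: "nat \<Rightarrow> 'r set"
  assume prime: "\<forall>i\<le>k. primeideal (C i) class_ring" and chain: "\<forall>i<k. C i \<subset> C (Suc i)"
    and top: "C k = {x. p dvd x}"
  have "k \<le> 1"
  proof (rule ccontr)
    assume "\<not> k \<le> 1"
    then obtain l where k: "k = Suc (Suc l)"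
      by (metis One_nat_def Suc_le_eq not_less0 old.nat.exhaust linorder_not_less)
    then have "C (Suc l) = {0}"
      using primeideal_in_multiples[OF p] prime chain top by (metis le_SucI lessI order_refl)
    moreover have "C l \<subset> C (Suc l)"
      using chain k by simp
    moreover have "0 \<in> C l"
    proof -
      interpret primeideal "C l" class_ring
        using prime k by simp
      show ?thesis
        using zero_closed by simp
    qed
    ultimately show False
      by auto
  qed
  then show "enat k \<le> 1"
    by (simp add: one_enat_def)
qed

lemma codimension_le_1:
  fixes p :: "'r::ufd"
  assumes "prime_elem p" "I \<subseteq> {x. p dvd x}"
  shows "codimension I \<le> 1"
proof -
  have "codimension I \<le> height {x. p dvd x}"
    unfolding codimension_def
  proof (rule Inf_lower)
    show "height {x. p dvd x} \<in> {height P |P. primeideal P class_ring \<and> I \<subseteq> P}"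
      using primeideal_multiples[OF assms(1)] assms(2) by auto
  qed
  also have "\<dots> \<le> 1"
    by (rule height_multiples_le[OF assms(1)])
  finally show ?thesis .
qed

lemma common_divisor_of_minors:
  fixes A :: "'r::ufd mat"
  assumes A: "A \<in> carrier_mat n m" and "n < m"
    and 0: "\<forall>J \<subseteq> {..<m}. card J = n \<longrightarrow> j \<notin> J \<longrightarrow> det (submatrix A UNIV J) = 0"
  shows "\<exists>w \<in> carrier_vec n. \<forall>p J. prime_elem p \<longrightarrow> p dvd col A j \<bullet> w \<longrightarrow>
    J \<subseteq> {..<m} \<longrightarrow> card J = n \<longrightarrow> p dvd det (submatrix A UNIV J)"
proof (cases "\<forall>J \<subseteq> {..<m}. card J = n \<longrightarrow> det (submatrix A UNIV J) = 0")
  case True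
  \<comment> \<open>Every prime divides the zero scalar product, but it also divides all minors,
    since they are zero.\<close>
  then show ?thesis
    by (intro bexI[of _ "0\<^sub>v n"]) auto
next
  case False
  then obtain w where w: "w \<in> carrier_vec n" "w \<noteq> 0\<^sub>v n" "\<And>k. k < m \<Longrightarrow> k \<noteq> j \<Longrightarrow> col A k \<bullet> w = 0"
    using exists_left_kernel_of_other_columns[OF A \<open>n < m\<close> _ _ _ 0] by blast
  obtain g v where g: "g \<noteq> 0" and v: "v \<in> carrier_vec n" and wgv: "w = g \<cdot>\<^sub>v v"
    and prim: "\<And>p. \<not> p dvd 1 \<Longrightarrow> \<exists>i<n. \<not> p dvd v $ i"
    using exists_primitive_part[OF w(1,2)] by blast
  have v0: "col A k \<bullet> v = 0" if "k < m" "k \<noteq> j" for k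
    using w(3)[OF that] g v A by (simp add: wgv)
  show ?thesis
  proof (intro bexI[OF _ v] allI impI)
    fix p J
    assume p: "prime_elem p" "p dvd col A j \<bullet> v" and J: "J \<subseteq> {..<m}" "card J = n"
    \<comment> \<open>Primitivity supplies a coordinate not divisible by \<open>p\<close>, which can
      then be cancelled from the adjugate relation by primality.\<close>
    obtain i where i: "i < n" "\<not> p dvd v $ i"
      using prim p(1) by (metis prime_elem_not_unit)
    have "p dvd det (submatrix A UNIV J) * v $ i"
      using p(2) v0 J by (blast intro: dvd_trans col_scalar_prod_dvd_minor_mult[OF A J v _ i(1)])
    then show "p dvd det (submatrix A UNIV J)"
      using p(1) i(2) by (simp add: prime_elem_dvd_mult_iff)
  qed
qed

section \<open>Degrees in the Buchsbaum--Rim complex\<close>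

text \<open>Taking the constant coefficient, that is, evaluating at the origin, is
  multiplicative.\<close>

lemma not_dvd_1_if_constant_coeff_0:
  fixes p :: "'k::comm_semiring_1 poly3"
  assumes "coeff (coeff (coeff p 0) 0) 0 = 0"
  shows "\<not> p dvd 1"
proof
  assume "p dvd 1"
  then obtain q where "1 = p * q" ..
  then have "coeff (coeff (coeff 1 0) 0) 0 = coeff (coeff (coeff (p * q) 0) 0) (0::nat)"
    by simp
  then show False
    using assms by (simp add: coeff_mult_0)
qed

lemma constant_coeff_0_if_graded_part:
  assumes "p \<in> graded_part e" "e > 0"
  shows "coeff (coeff (coeff p 0) 0) 0 = 0"
proof (rule ccontr)
  assume "coeff (coeff (coeff p 0) 0) 0 \<noteq> 0"
  then have "int (0 + 0 + 0) = e"
    using assms(1) unfolding graded_part_def by blast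
  then show False
    using assms(2) by simp
qed

lemma codimension_maximal_minors_le_1:
  fixes A :: "'k::field poly3 mat"
  assumes A: "A \<in> carrier_mat n m" and "n < m" and j: "j < m"
    and 0: "\<forall>J \<subseteq> {..<m}. card J = n \<longrightarrow> j \<notin> J \<longrightarrow> det (submatrix A UNIV J) = 0"
    and const: "\<And>i. i < n \<Longrightarrow> coeff (coeff (coeff (A $$ (i, j)) 0) 0) 0 = 0"
  shows "codimension (maximal_minors_ideal n A) \<le> 1"
proof -
  obtain w where w: "w \<in> carrier_vec n"
    and dvd: "\<forall>p J. prime_elem p \<longrightarrow> p dvd col A j \<bullet> w \<longrightarrow>
      J \<subseteq> {..<m} \<longrightarrow> card J = n \<longrightarrow> p dvd det (submatrix A UNIV J)"
    using common_divisor_of_minors[OF A \<open>n < m\<close> 0] by (rule bexE)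
  \<comment> \<open>If the scalar product is \<open>0\<close>, every prime divides it, so any prime
    will do. The variable \<open>z\<close>, written \<open>[:0, 1:]\<close>, then serves as a
    nonzero nonunit from which to take one.\<close>
  define f where "f = (if col A j \<bullet> w = 0 then [:0, 1:] else col A j \<bullet> w)"
  have "coeff (coeff (coeff (col A j \<bullet> w) 0) 0) 0 = 0"
    using A w j const by (simp add: scalar_prod_def coeff_sum coeff_mult_0)
  then have "coeff (coeff (coeff f 0) 0) 0 = 0"
    by (simp add: f_def)
  then have "\<not> f dvd 1"
    by (rule not_dvd_1_if_constant_coeff_0)
  moreover have "f \<noteq> 0"
    by (simp add: f_def)
  ultimately obtain p where p: "prime_elem p" "p dvd f"
    using exists_prime_elem_dvd[of f] by auto
  then have "p dvd col A j \<bullet> w"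
    by (cases "col A j \<bullet> w = 0") (auto simp: f_def)
  then have "{det (submatrix A UNIV J) |J. J \<subseteq> {..<dim_col A} \<and> card J = n} \<subseteq> {x. p dvd x}"
    using dvd p(1) A by auto
  then have "maximal_minors_ideal n A \<subseteq> {x. p dvd x}"
    unfolding maximal_minors_ideal_def
    using primeideal.axioms(1)[OF primeideal_multiples[OF p(1)]]
    by (intro ring.genideal_minimal class_ring.ring_axioms)
  then show ?thesis
    by (rule codimension_le_1[OF p(1)])
qed

lemma exists_nonzero_minor_deleting:
  fixes A :: "'k::field poly3 mat"
  assumes A: "A \<in> carrier_mat n (n + 2)" and j: "j < n + 2"
    and codim: "codimension (maximal_minors_ideal n A) > 1"
    and const: "\<And>i. i < n \<Longrightarrow> coeff (coeff (coeff (A $$ (i, j)) 0) 0) 0 = 0"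
  shows "\<exists>r<n + 2. r \<noteq> j \<and> minor_deleting A r j \<noteq> 0"
proof (rule ccontr)
  assume none: "\<not> ?thesis"
  have "det (submatrix A UNIV J) = 0" if J: "J \<subseteq> {..<n + 2}" "card J = n" "j \<notin> J" for J
  proof -
    \<comment> \<open>A set of \<open>n\<close> columns avoiding \<open>j\<close> omits exactly one
      further column among the \<open>n + 2\<close>, so it is one of the sets used by
      \<open>minor_deleting\<close>.\<close>
    have "card ({..<n + 2} - insert j J) = 1"
      using J j finite_subset[OF J(1)] by (subst card_Diff_subset) auto
    then obtain r where r: "{..<n + 2} - insert j J = {r}"
      by (auto simp: card_1_singleton_iff)
    then have "J = {..<n + 2} - {r, j}"
      using J by blast
    moreover have "r < n + 2" "r \<noteq> j"
      using r by auto
    ultimately show ?thesis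
      using none A by (auto simp: minor_deleting_eq)
  qed
  then have "codimension (maximal_minors_ideal n A) \<le> 1"
    by (intro codimension_maximal_minors_le_1[OF A _ j]) (auto simp: const)
  then show False
    using codim by simp
qed

theorem corollary2p5:
  fixes \<phi> :: "'k::alg_closed_field poly3 mat"
    and n :: nat
    and a b c d :: "nat \<Rightarrow> int"
  assumes "n > 0"
    and "mono_on {..<n} a"
    and "mono_on {..<n + 2} b"
    and "degree_zero_map \<phi> (n + 2) b n a"
    and "\<forall>i<n. \<forall>j<n + 2. \<phi> $$ (i, j) = 0 \<or> (\<exists>e>0. \<phi> $$ (i, j) \<in> graded_part e)"
    and "codimension (maximal_minors_ideal n \<phi>) = 3"
    and "degree_zero_map (eps_mat n \<phi>) (n + 2) c (n + 2) b"
    and "degree_zero_map (delta_mat n \<phi>) n d (n + 2) c"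
  shows "\<forall>i<n. d i = ((\<Sum>j<n + 2. b j) - (\<Sum>i<n. a i)) - a i"
proof (intro allI impI)
  fix i assume i: "i < n"
  have \<phi>: "\<phi> \<in> carrier_mat n (n + 2)"
    using assms(4) by (simp add: degree_zero_map_def)
  have deg: "\<phi> $$ (i, j) \<in> graded_part (b j - a i)" if "i < n" "j < n + 2" for i j
    using degree_zero_map_entry[OF assms(4)] that by simp
  have const: "coeff (coeff (coeff (\<phi> $$ (i, j)) 0) 0) 0 = 0" if "i < n" "j < n + 2" for i j
    using assms(5) that constant_coeff_0_if_graded_part by (metis coeff_0)
  have codim: "codimension (maximal_minors_ideal n \<phi>) > 1"
    by (simp add: assms(6))
  have minor: "\<exists>r<n + 2. r \<noteq> j \<and> minor_deleting \<phi> r j \<noteq> 0" if "j < n + 2" for j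
    using exists_nonzero_minor_deleting[OF \<phi> that codim] const that by simp
  \<comment> \<open>If row \<open>i\<close> were zero, the \<open>i\<close>-th unit vector would be
    in the left kernel of every set of columns, contradicting the existence of a nonzero
    minor.\<close>
  have "\<exists>j<n + 2. \<phi> $$ (i, j) \<noteq> 0"
  proof (rule ccontr)
    assume zero: "\<not> ?thesis"
    obtain r where r: "r < n + 2" "r \<noteq> 0" "minor_deleting \<phi> r 0 \<noteq> 0"
      using minor[of 0] by auto
    let ?J = "{..<n + 2} - {r, 0}"
    have J: "?J \<subseteq> {..<n + 2}" "card ?J = n"
      using r by (auto simp: card_Diff_subset)
    have "\<forall>k\<in>?J. col \<phi> k \<bullet> unit_vec n i = 0"
      using \<phi> i zero by simp
    moreover have "unit_vec n i \<noteq> (0\<^sub>v n :: 'k poly3 vec)"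
      using i by simp
    ultimately have "det (submatrix \<phi> UNIV ?J) = 0"
      using minor_eq_0_iff_left_kernel[OF \<phi> J] unit_vec_carrier by blast
    then show False
      using r \<phi> by (simp add: minor_deleting_eq)
  qed
  then obtain j where j: "j < n + 2" "\<phi> $$ (i, j) \<noteq> 0"
    by blast
  obtain r where r: "r < n + 2" "r \<noteq> j" "minor_deleting \<phi> r j \<noteq> 0"
    using minor[OF j(1)] by blast
  let ?J = "{..<n + 2} - {r, j}"
  have "card ?J = n"
    using r j by (simp add: card_Diff_subset)
  \<comment> \<open>The degree of this minor is computed twice: as a determinant, and as an entry of
    \<open>eps_mat\<close> up to sign. Since the minor is nonzero, this determines
    \<open>c j\<close>.\<close>
  then have "minor_deleting \<phi> r j \<in> graded_part ((\<Sum>k\<in>?J. b k) - (\<Sum>i<n. a i))"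
    using minor_in_graded_part[OF \<phi> _ _ deg] \<phi> by (simp add: minor_deleting_eq)
  moreover have "minor_deleting \<phi> r j \<in> graded_part (c j - b r)"
    using degree_zero_map_entry[OF assms(7) r(1) j(1)] r j
    by (simp add: eps_mat_def split: if_splits)
  ultimately have "c j - b r = (\<Sum>k\<in>?J. b k) - (\<Sum>i<n. a i)"
    using graded_part_unique r(3) by blast
  moreover have "(\<Sum>k\<in>?J. b k) = (\<Sum>k<n + 2. b k) - (b r + b j)"
    using r j by (subst sum_diff) auto
  \<comment> \<open>The same nonzero entry occurs up to sign in \<open>delta_mat\<close>. Comparing
    its two degrees expresses \<open>d i\<close> through \<open>c j\<close>, and in the final sum
    \<open>b r\<close>, \<open>b j\<close> and \<open>c j\<close> cancel.\<close>
  moreover have "\<phi> $$ (i, j) \<in> graded_part (d i - c j)"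
    using degree_zero_map_entry[OF assms(8) j(1) i] i j by (simp add: delta_mat_def)
  then have "d i - c j = b j - a i"
    using graded_part_unique deg[OF i j(1)] j(2) by blast
  ultimately show "d i = ((\<Sum>j<n + 2. b j) - (\<Sum>i<n. a i)) - a i"
    by simp
qed

end
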